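(* Let $d\geq 1$ and $n\geq 2$ be positive integers. Then the following hold: (a) There exist a set $P$ of $n$ points in $\mathbb{R}^d$ and a family $\mathcal{B}$ of $n-1$ bicolorings of $P$ for which any geometric system of unbiased representatives (G-SUR) consisting of Euclidean balls has size at least $n-1$. (b) For any set $P$ of $n$ points in $\mathbb{R}^d$ there exists a set $\mathcal{O}$ of $n-1$ Euclidean balls such that for any bicoloring $B$ of $P$ there is at least one ball in $\mathcal{O}$ that is balanced with respect to $B$.
   Context: A bicoloring of $P$ is a map $B:P\to\{\text{Red},\text{Blue}\}$ that colors at least one point red and at least one point blue. A ball $O\subset\mathbb{R}^d$ is balanced with respect to $B$ if $O\cap P$ is nonempty and contains the same number of red and blue points with respect to $B$. Given a family $\mathcal{B}$ of bicolorings of $P$, a G-SUR for $\mathcal{B}$ consisting of Euclidean balls is a family $\mathcal{O}'$ of Euclidean balls in $\mathbb{R}^d$ such that for every $B\in\mathcal{B}$ at least one ball in $\mathcal{O}'$ is balanced with respect to $B$; its size is the number of balls in $\mathcal{O}'$. *)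

theory Defs
  imports "HOL-Analysis.Analysis"
begin

datatype color = Red | Blue

text \<open>Maps from P to colors are represented as extensional functions, so that equality of
  bicolorings, and hence the cardinality of a set of bicolorings, only depends on the values on P.\<close>

definition bicoloring :: "'a set \<Rightarrow> ('a \<Rightarrow> color) \<Rightarrow> bool" where
  "bicoloring P B \<longleftrightarrow> B \<in> P \<rightarrow>\<^sub>E UNIV \<and> (\<exists>p\<in>P. B p = Red) \<and> (\<exists>p\<in>P. B p = Blue)"

text \<open>Open and closed balls are both admitted: for finite P every set P \<inter> S with S an open
  ball of positive radius is also of the form P \<inter> T with T a closed one, and vice versa.\<close>

definition euclidean_ball :: "(real ^ 'd) set \<Rightarrow> bool" where
  "euclidean_ball S \<longleftrightarrow> (\<exists>c r. 0 < r \<and> (S = ball c r \<or> S = cball c r))"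

text \<open>Only meaningful for finite P, because of the convention that infinite sets have
  cardinality 0.\<close>

definition balanced :: "'a set \<Rightarrow> ('a \<Rightarrow> color) \<Rightarrow> 'a set \<Rightarrow> bool" where
  "balanced P B S \<longleftrightarrow> S \<inter> P \<noteq> {} \<and>
     card {p \<in> S \<inter> P. B p = Red} = card {p \<in> S \<inter> P. B p = Blue}"

definition ball_gsur :: "(real ^ 'd) set \<Rightarrow> (real ^ 'd \<Rightarrow> color) set \<Rightarrow> (real ^ 'd) set set \<Rightarrow> bool" where
  "ball_gsur P \<B> \<O> \<longleftrightarrow>
     (\<forall>S\<in>\<O>. euclidean_ball S) \<and> (\<forall>B\<in>\<B>. \<exists>S\<in>\<O>. balanced P B S)"

end

theory Submission
  imports Defs
begin

text \<open>For (a), put the points on a line and let the coloring with index i paint the first i points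
  red. By convexity a ball meets the points in an interval, and the interval is balanced only
  if it is centred between the points i and i + 1; so no ball serves two of the colorings.

  For (b), use closed balls whose diameters are the edges of a Euclidean minimum spanning tree.
  Such a ball contains no point of P besides the ends of the edge, so it is balanced when the ends
  have different colors, which happens for some edge since the tree is connected.
  The tree is grown as in Prim's algorithm.\<close>

section \<open>Diametral balls of closest pairs\<close>

text \<open>By Thales, a point of the ball with diameter \<open>p q\<close> sees the ends under an
  angle of at least 90 degrees, so the opposite side is the longest; \<open>r \<noteq> p\<close>
  makes this strict.\<close>

lemma dist_less_in_diametral_cball:
  fixes p q r :: "'a :: real_inner"
  assumes "r \<in> cball (midpoint p q) (dist p q / 2)" and "r \<noteq> p"
  shows "dist r q < dist p q"
proof -
  \<comment> \<open>Seen from \<open>r\<close>, the centre is half the sum of the vectors to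
    \<open>p\<close> and \<open>q\<close>, and the diameter is the norm of their difference.\<close>
  have "(p - r) + (q - r) = 2 *\<^sub>R (midpoint p q - r)"
    by (simp add: midpoint_def scaleR_diff_right) (simp add: scaleR_2)
  then have "dist (midpoint p q) r = norm ((p - r) + (q - r)) / 2"
    by (simp add: dist_norm)
  moreover have "dist p q = norm ((p - r) - (q - r))"
    by (simp add: dist_norm)
  ultimately have "norm ((p - r) + (q - r)) \<le> norm ((p - r) - (q - r))"
    using assms(1) by simp
  then have "((p - r) + (q - r)) \<bullet> ((p - r) + (q - r)) \<le> ((p - r) - (q - r)) \<bullet> ((p - r) - (q - r))"
    by (simp add: norm_le)
  then have obtuse: "(p - r) \<bullet> (q - r) \<le> 0"
    by (simp add: inner_add inner_diff inner_commute)
  \<comment> \<open>Law of cosines in the triangle with vertices \<open>p\<close>, \<open>q\<close>,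
    \<open>r\<close>.\<close>
  have "(p - q) \<bullet> (p - q) = (p - r) \<bullet> (p - r) + (r - q) \<bullet> (r - q) - 2 * ((p - r) \<bullet> (q - r))"
    by (simp add: inner_diff inner_commute)
  moreover have "0 < (p - r) \<bullet> (p - r)"
    using assms(2) by simp
  ultimately have "(r - q) \<bullet> (r - q) < (p - q) \<bullet> (p - q)"
    using obtuse by linarith
  then show ?thesis
    by (simp add: dist_norm norm_lt)
qed

text \<open>Choose \<open>p\<close>, \<open>q\<close> at minimal distance across the cut. A third
  point of \<open>P\<close> in the ball would form a shorter crossing pair, with \<open>q\<close> if
  it lies in \<open>Q\<close> and with \<open>p\<close> otherwise.\<close>

lemma closest_pair_diametral_cball:
  fixes P Q :: "'a :: real_inner set"
  assumes "finite P" "Q \<subseteq> P" "Q \<noteq> {}" "Q \<noteq> P"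
  obtains p q where "p \<in> Q" "q \<in> P - Q" "cball (midpoint p q) (dist p q / 2) \<inter> P = {p, q}"
proof -
  let ?X = "Q \<times> (P - Q)"
  have "finite ?X" "?X \<noteq> {}"
    using assms by (auto intro: finite_subset)
  then obtain z where "z \<in> ?X" "\<And>w. w \<in> ?X \<Longrightarrow> dist (fst z) (snd z) \<le> dist (fst w) (snd w)"
    using arg_min_if_finite[of ?X "\<lambda>z. dist (fst z) (snd z)"] by (meson not_le)
  then obtain p q where pq: "p \<in> Q" "q \<in> P - Q"
    and min: "\<And>x y. x \<in> Q \<Longrightarrow> y \<in> P - Q \<Longrightarrow> dist p q \<le> dist x y"
    by fastforce
  have "r = p \<or> r = q" if r: "r \<in> cball (midpoint p q) (dist p q / 2)" "r \<in> P" for r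
  proof (rule ccontr)
    assume ne: "\<not> (r = p \<or> r = q)"
    show False
    proof (cases "r \<in> Q")
      case True
      then show False
        using dist_less_in_diametral_cball[OF r(1)] ne min pq by fastforce
    next
      case False
      have "dist r p < dist q p"
        using dist_less_in_diametral_cball[of r q p] r(1) ne
        by (simp add: midpoint_sym dist_commute)
      then show False
        using False r(2) min[OF pq(1), of r] by (simp add: dist_commute)
    qed
  qed
  moreover have "p \<in> cball (midpoint p q) (dist p q / 2)"
    "q \<in> cball (midpoint p q) (dist p q / 2)"
    by (simp_all add: dist_midpoint)
  ultimately have "cball (midpoint p q) (dist p q / 2) \<inter> P = {p, q}"
    using pq assms(2) by blast
  then show thesis
    using that pq by blast
qed

section \<open>Balls along a minimum spanning tree\<close>

lemma balanced_pair:
  assumes "S \<inter> P = {p, q}" "B p \<noteq> B q"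
  shows "balanced P B S"
proof -
  have "{x \<in> S \<inter> P. B x = B p} = {p}" "{x \<in> S \<inter> P. B x = B q} = {q}"
    using assms by auto
  then show ?thesis
    using assms unfolding balanced_def by (cases "B p"; cases "B q") auto
qed

text \<open>The condition that the balls meet P only inside Q makes each new ball differ from the
  previous ones.\<close>

lemma spanning_tree_balls:
  fixes P :: "(real ^ 'd) set"
  assumes "finite P" "Suc k \<le> card P"
  shows "\<exists>Q \<O>. Q \<subseteq> P \<and> card Q = Suc k \<and> finite \<O> \<and> card \<O> = k \<and>
    (\<forall>S\<in>\<O>. euclidean_ball S \<and> S \<inter> P \<subseteq> Q) \<and>
    (\<forall>B. (\<exists>x\<in>Q. \<exists>y\<in>Q. B x \<noteq> B y) \<longrightarrow> (\<exists>S\<in>\<O>. balanced P B S))"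
  using assms(2)
proof (induction k)
  case 0
  then obtain p where "p \<in> P"
    by fastforce
  then show ?case
    by (intro exI[of _ "{p}"] exI[of _ "{}"]) simp
next
  case (Suc k)
  then obtain Q \<O> where Q: "Q \<subseteq> P" "card Q = Suc k" and O: "finite \<O>" "card \<O> = k"
    and ball: "\<And>S. S \<in> \<O> \<Longrightarrow> euclidean_ball S \<and> S \<inter> P \<subseteq> Q"
    and bal: "\<And>B. \<exists>x\<in>Q. \<exists>y\<in>Q. B x \<noteq> B y \<Longrightarrow> \<exists>S\<in>\<O>. balanced P B S"
    by (metis Suc_leD)
  have "Q \<noteq> {}" "Q \<noteq> P"
    using Q Suc.prems by auto
  then obtain p q where pq: "p \<in> Q" "q \<in> P - Q"
    and pair: "cball (midpoint p q) (dist p q / 2) \<inter> P = {p, q}"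
    using closest_pair_diametral_cball[OF assms(1) Q(1)] by metis
  let ?S = "cball (midpoint p q) (dist p q / 2)"
  have "0 < dist p q / 2"
    using pq by auto
  then have S: "euclidean_ball ?S"
    unfolding euclidean_ball_def by blast
  have "?S \<notin> \<O>"
    using ball pair pq(2) by blast
  have "\<exists>S\<in>insert ?S \<O>. balanced P B S" if "\<exists>x\<in>insert q Q. \<exists>y\<in>insert q Q. B x \<noteq> B y" for B
  proof (cases "\<exists>x\<in>Q. \<exists>y\<in>Q. B x \<noteq> B y")
    case True
    then show ?thesis
      using bal by blast
  next
    case False
    \<comment> \<open>As \<open>B\<close> is constant on \<open>Q\<close>, the two colors can only
      differ at the new point \<open>q\<close>.\<close>
    then have "B p \<noteq> B q"
      using that pq(1) by (metis insert_iff)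
    then show ?thesis
      using balanced_pair[OF pair] by blast
  qed
  moreover have "card (insert q Q) = Suc (Suc k)"
    using Q pq(2) finite_subset[OF Q(1) assms(1)] by simp
  moreover have "card (insert ?S \<O>) = Suc k"
    using O \<open>?S \<notin> \<O>\<close> by simp
  moreover have "\<forall>S\<in>insert ?S \<O>. euclidean_ball S \<and> S \<inter> P \<subseteq> insert q Q"
    using ball S pair pq(1) by auto
  ultimately show ?case
    using Q(1) O(1) pq(2)
    by (intro exI[of _ "insert q Q"] exI[of _ "insert ?S \<O>"]) auto
qed

text \<open>With \<open>card P - 1\<close> edges the tree reaches all of \<open>P\<close>, and a
  bicoloring is not constant there.\<close>

lemma ball_system_exists:
  fixes P :: "(real ^ 'd) set"
  assumes "finite P" "P \<noteq> {}"
  shows "\<exists>\<O>. card \<O> = card P - 1 \<and> (\<forall>S\<in>\<O>. euclidean_ball S) \<and>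
    (\<forall>B. bicoloring P B \<longrightarrow> (\<exists>S\<in>\<O>. balanced P B S))"
proof -
  have "Suc (card P - 1) = card P"
    using assms card_gt_0_iff[of P] by simp
  then obtain Q \<O> where Q: "Q \<subseteq> P" "card Q = card P" and "card \<O> = card P - 1"
    and "\<forall>S\<in>\<O>. euclidean_ball S"
    and bal: "\<And>B. \<exists>x\<in>Q. \<exists>y\<in>Q. B x \<noteq> B y \<Longrightarrow> \<exists>S\<in>\<O>. balanced P B S"
    using spanning_tree_balls[OF assms(1), of "card P - 1"] by auto
  moreover have "Q = P"
    using Q assms(1) card_subset_eq by blast
  ultimately show ?thesis
    unfolding bicoloring_def by (metis color.distinct(1))
qed

section \<open>Colorings of collinear points by initial segments\<close>

text \<open>Restricting to the \<open>n\<close> points makes the coloring extensional, as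
  \<open>bicoloring\<close> demands.\<close>

definition prefix_coloring :: "(nat \<Rightarrow> 'a) \<Rightarrow> nat \<Rightarrow> nat \<Rightarrow> 'a \<Rightarrow> color" where
  "prefix_coloring f n i = restrict (\<lambda>x. if x \<in> f ` {..<i} then Red else Blue) (f ` {..<n})"

lemma prefix_coloring_apply:
  assumes "inj f" "k < n"
  shows "prefix_coloring f n i (f k) = (if k < i then Red else Blue)"
  using assms by (auto simp: prefix_coloring_def inj_image_mem_iff)

lemma bicoloring_prefix_coloring:
  assumes "inj f" "0 < i" "i < n"
  shows "bicoloring (f ` {..<n}) (prefix_coloring f n i)"
proof -
  have "prefix_coloring f n i (f 0) = Red" "prefix_coloring f n i (f i) = Blue"
    using assms by (simp_all add: prefix_coloring_apply)
  moreover have "f 0 \<in> f ` {..<n}" "f i \<in> f ` {..<n}"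
    using assms by auto
  moreover have "prefix_coloring f n i \<in> f ` {..<n} \<rightarrow>\<^sub>E UNIV"
    unfolding prefix_coloring_def by simp
  ultimately show ?thesis
    unfolding bicoloring_def by blast
qed

lemma inj_on_prefix_coloring:
  assumes "inj f"
  shows "inj_on (prefix_coloring f n) {1..<n}"
proof (rule linorder_inj_onI')
  fix i j assume "i \<in> {1..<n}" "j \<in> {1..<n}" "i < j"
  \<comment> \<open>The point \<open>f i\<close> is the first blue one for the cut \<open>i\<close>,
    but still red for the later cut \<open>j\<close>.\<close>
  then have "prefix_coloring f n i (f i) \<noteq> prefix_coloring f n j (f i)"
    using assms by (simp add: prefix_coloring_apply)
  then show "prefix_coloring f n i \<noteq> prefix_coloring f n j"
    by auto
qed

text \<open>Injectivity of \<open>f\<close> turns counting points by color into counting indices on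
  either side of the cut \<open>i\<close>.\<close>

lemma balanced_prefix_coloring_iff:
  assumes "inj f"
  shows "balanced (f ` {..<n}) (prefix_coloring f n i) S \<longleftrightarrow>
    (\<exists>k<n. f k \<in> S) \<and> card {k. k < n \<and> f k \<in> S \<and> k < i} = card {k. k < n \<and> f k \<in> S \<and> i \<le> k}"
proof -
  have "{p \<in> S \<inter> f ` {..<n}. prefix_coloring f n i p = Red} = f ` {k. k < n \<and> f k \<in> S \<and> k < i}"
    using assms by (auto simp: prefix_coloring_apply split: if_splits)
  moreover have "{p \<in> S \<inter> f ` {..<n}. prefix_coloring f n i p = Blue} = f ` {k. k < n \<and> f k \<in> S \<and> i \<le> k}"
    using assms by (auto simp: prefix_coloring_apply split: if_splits)
  moreover have "card (f ` A) = card A" for A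
    using assms by (meson card_image inj_on_subset subset_UNIV)
  ultimately show ?thesis
    unfolding balanced_def by auto
qed

text \<open>A balanced cut leaves half of \<open>K\<close> on each side. Two such cuts would have no
  element of \<open>K\<close> between them, although \<open>K\<close> is an interval with elements
  on both sides.\<close>

lemma balanced_cut_unique:
  fixes K :: "nat set"
  assumes "finite K" "K \<noteq> {}"
    and interval: "\<And>a b c. a \<in> K \<Longrightarrow> c \<in> K \<Longrightarrow> a \<le> b \<Longrightarrow> b \<le> c \<Longrightarrow> b \<in> K"
    and i: "card {k\<in>K. k < i} = card {k\<in>K. i \<le> k}"
    and j: "card {k\<in>K. k < j} = card {k\<in>K. j \<le> k}"
  shows "i = j"
proof -
  have split: "card K = card {k\<in>K. k < m} + card {k\<in>K. m \<le> k}" for m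
  proof -
    have "K = {k\<in>K. k < m} \<union> {k\<in>K. m \<le> k}"
      by auto
    moreover have "{k\<in>K. k < m} \<inter> {k\<in>K. m \<le> k} = {}"
      by auto
    ultimately show ?thesis
      using assms(1) by (metis (no_types, lifting) card_Un_disjoint finite_Un)
  qed
  have pos: "0 < card K"
    using assms(1,2) by (simp add: card_gt_0_iff)
  have False if m: "l < m" "card {k\<in>K. k < l} = card {k\<in>K. l \<le> k}"
    "card {k\<in>K. k < m} = card {k\<in>K. m \<le> k}" for l m
  proof -
    \<comment> \<open>Both counts are half of \<open>card K\<close>.\<close>
    have eq: "card {k\<in>K. k < l} = card {k\<in>K. k < m}"
      using split[of l] split[of m] m by linarith
    have "0 < card {k\<in>K. k < l}" "0 < card {k\<in>K. m \<le> k}"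
      using split[of l] split[of m] m pos by linarith+
    then obtain a c where "a \<in> K" "a < l" "c \<in> K" "m \<le> c"
      by (auto simp: card_gt_0_iff)
    \<comment> \<open>The cut position \<open>l\<close> itself is the contradictory element: it lies
      below \<open>m\<close> but not below \<open>l\<close>.\<close>
    then have "l \<in> K"
      using interval[of a c l] \<open>l < m\<close> by simp
    then have "{k\<in>K. k < l} \<subset> {k\<in>K. k < m}"
      using \<open>l < m\<close> by fastforce
    then show False
      using eq psubset_card_mono[of "{k\<in>K. k < m}" "{k\<in>K. k < l}"] assms(1) by simp
  qed
  from this[of i j] this[of j i] show ?thesis
    using i j by (metis nat_neq_iff)
qed

lemma convex_balanced_prefix_coloring_unique:
  fixes e :: "'a :: real_vector"
  defines "f \<equiv> \<lambda>k. real k *\<^sub>R e"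
  assumes "e \<noteq> 0" "convex S"
    and i: "balanced (f ` {..<n}) (prefix_coloring f n i) S"
    and j: "balanced (f ` {..<n}) (prefix_coloring f n j) S"
  shows "i = j"
proof -
  have "inj f"
    unfolding f_def using assms(2) by (simp add: inj_def)
  define K where "K = {k. k < n \<and> f k \<in> S}"
  have K: "{k. k < n \<and> f k \<in> S \<and> Q k} = {k\<in>K. Q k}" for Q
    unfolding K_def by auto
  \<comment> \<open>Pulling \<open>S\<close> back to the line spanned by \<open>e\<close> gives a
    convex set of reals, hence an interval.\<close>
  have "convex ((\<lambda>x. x *\<^sub>R e) -` S)"
    using assms(3) by (intro convex_linear_vimage linear_scaleR_left)
  then have "is_interval ((\<lambda>x. x *\<^sub>R e) -` S)"
    by (simp add: is_interval_convex_1)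
  then have "b \<in> K" if "a \<in> K" "c \<in> K" "a \<le> b" "b \<le> c" for a b c
  proof -
    have "real b \<in> (\<lambda>x. x *\<^sub>R e) -` S"
      using that mem_is_interval_1_I[OF \<open>is_interval _\<close>, of "real a" "real c" "real b"]
      unfolding K_def f_def by simp
    then show ?thesis
      using that unfolding K_def f_def by simp
  qed
  moreover have "finite K" "K \<noteq> {}"
    using i unfolding K_def balanced_prefix_coloring_iff[OF \<open>inj f\<close>] by auto
  ultimately show ?thesis
    using balanced_cut_unique[of K i j] i j
    unfolding balanced_prefix_coloring_iff[OF \<open>inj f\<close>] K by blast
qed

section \<open>The lower bound and the conclusion\<close>

lemma ball_gsur_lower_bound_exists:
  "\<exists>(P :: (real ^ 'd) set) \<B>. card P = n \<and> card \<B> = n - 1 \<and> (\<forall>B\<in>\<B>. bicoloring P B) \<and>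
    (\<forall>\<O>. ball_gsur P \<B> \<O> \<longrightarrow> infinite \<O> \<or> n - 1 \<le> card \<O>)"
proof -
  \<comment> \<open>A direction for the line exists because the dimension is at least 1.\<close>
  obtain e :: "real ^ 'd" where e: "e \<noteq> 0"
    using nonempty_Basis nonzero_Basis by blast
  define f where "f = (\<lambda>k. real k *\<^sub>R e)"
  have inj: "inj f"
    unfolding f_def using e by (simp add: inj_def)
  let ?P = "f ` {..<n}" and ?B = "prefix_coloring f n"
  let ?\<B> = "?B ` {1..<n}"
  have P: "card ?P = n"
    using inj by (metis card_image card_lessThan inj_on_subset subset_UNIV)
  have B: "card ?\<B> = n - 1"
    using card_image[OF inj_on_prefix_coloring[OF inj]] by simp
  have "n - 1 \<le> card \<O>" if gsur: "ball_gsur ?P ?\<B> \<O>" and fin: "finite \<O>" for \<O>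
  proof -
    have "\<forall>i\<in>{1..<n}. \<exists>S. S \<in> \<O> \<and> balanced ?P (?B i) S"
      using gsur unfolding ball_gsur_def by blast
    from bchoice[OF this] obtain g where g: "\<And>i. i \<in> {1..<n} \<Longrightarrow> g i \<in> \<O> \<and> balanced ?P (?B i) (g i)"
      by blast
    \<comment> \<open>Assigning to each coloring a ball that balances it is injective, since balls
      are convex.\<close>
    have "inj_on g {1..<n}"
    proof (rule inj_onI)
      fix i j assume ij: "i \<in> {1..<n}" "j \<in> {1..<n}" "g i = g j"
      have "convex (g i)"
        using gsur g[OF ij(1)] unfolding ball_gsur_def euclidean_ball_def by auto
      then show "i = j"
        using convex_balanced_prefix_coloring_unique[OF e, of "g i" n i j]
          g[OF ij(1)] g[OF ij(2)] ij(3)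
        unfolding f_def by simp
    qed
    moreover have "g ` {1..<n} \<subseteq> \<O>"
      using g by blast
    ultimately have "card {1..<n} \<le> card \<O>"
      using fin card_inj_on_le by blast
    then show ?thesis
      by simp
  qed
  moreover have "\<forall>B\<in>?\<B>. bicoloring ?P B"
    using bicoloring_prefix_coloring[OF inj] by auto
  ultimately show ?thesis
    using P B by blast
qed

theorem theorem5:
  fixes n :: nat
  assumes "n \<ge> 2"
  shows "(\<exists>(P :: (real ^ 'd) set) \<B>.
            card P = n \<and> card \<B> = n - 1 \<and> (\<forall>B\<in>\<B>. bicoloring P B) \<and>
            (\<forall>\<O>. ball_gsur P \<B> \<O> \<longrightarrow> infinite \<O> \<or> n - 1 \<le> card \<O>)) \<and>
         (\<forall>P :: (real ^ 'd) set. card P = n \<longrightarrow>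
            (\<exists>\<O>. card \<O> = n - 1 \<and> (\<forall>S\<in>\<O>. euclidean_ball S) \<and>
              (\<forall>B. bicoloring P B \<longrightarrow> (\<exists>S\<in>\<O>. balanced P B S))))"
proof (intro conjI allI impI)
  show "\<exists>(P :: (real ^ 'd) set) \<B>.
      card P = n \<and> card \<B> = n - 1 \<and> (\<forall>B\<in>\<B>. bicoloring P B) \<and>
      (\<forall>\<O>. ball_gsur P \<B> \<O> \<longrightarrow> infinite \<O> \<or> n - 1 \<le> card \<O>)"
    by (rule ball_gsur_lower_bound_exists)
next
  fix P :: "(real ^ 'd) set"
  assume P: "card P = n"
  \<comment> \<open>Infinite sets have cardinality 0, so \<open>n \<ge> 2\<close> rules out both bad
    cases.\<close>
  then have "finite P" "P \<noteq> {}"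
    using assms card.infinite by fastforce+
  from ball_system_exists[OF this] show "\<exists>\<O>. card \<O> = n - 1 \<and> (\<forall>S\<in>\<O>. euclidean_ball S) \<and>
      (\<forall>B. bicoloring P B \<longrightarrow> (\<exists>S\<in>\<O>. balanced P B S))"
    using P by simp
qed

end
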